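(* Let $X_1,X_2,\ldots$ be (possibly dependent) random variables with common continuous distribution function $F$, let $M_n=\max(X_1,\dots,X_n)$, and let $M_n^*=\max(X_1^*,\ldots,X_n^* )$ be the maximum corresponding to an iid sequence $X_1^*,X_2^*,\ldots\sim F$. Assume that there are a generalized extreme value distribution function $H$ and sequences $(d_n^* )$ and $(c_n^* )$, $c_n^*>0$, of real numbers such that for every $x\in\mathbb{R}$, $\lim_{n\to\infty}\mathbb{P}\left(\frac{M_n^*-d_n^*}{c_n^*}\le x\right)=H(x)$. For a rate function $r:\mathbb{N}\to(0,\infty)$, let $D_n^r$ be the diagonal power distortion of $X_1,\ldots,X_n$ with respect to $r$. (i) If there exists a function $r:\mathbb{N}\to(0,\infty)$ such that $\lim_{n\to\infty}r_n=\infty$ and $D_n^r$ converges pointwise to a continuous function $D$ on $[0,1]$, then, for all $x\in\mathbb{R}$, $$\lim_{n\to\infty}\mathbb{P}\left(\frac{M_n-d^*_{\lceil r_n\rceil}}{c^*_{\lceil r_n\rceil}}\le x\right)=D\circ H(x),$$ and $D$ is a continuous distribution function on $[0,1]$. (ii) If there exist a function $r:\mathbb{N}\to(0,\infty)$ such that $1/r_n=O(1/n)$ and a distribution function $D$ on $[0,1]$ (with $D(0)=0$ and $D(1)=1$) such that for all continuity points $x$ of $D\circ H$, $$\lim_{n\to\infty}\mathbb{P}\left(\frac{M_n-d^*_{\lceil r_n\rceil}}{c^*_{\lceil r_n\rceil}}\le x\right)=D\circ H(x),$$ then $\lim_{n\to\infty}D_n^r(u)=D(u)$ for $u\in\{0,1\}$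 and for all continuity points $u\in(0,1)$ of $D$.
   Context: Since $F$ is continuous, for each $n$ there is a unique copula $C_n$ (a distribution function on $[0,1]^n$ with standard uniform univariate margins) with $\mathbb{P}(X_1\le x_1,\dots,X_n\le x_n)=C_n(F(x_1),\dots,F(x_n))$. Its diagonal is $\delta_n(u)=C_n(u,\dots,u)$, $u\in[0,1]$. For a strictly positive function $r:\mathbb{N}\to(0,\infty)$ (a rate; write $r_n=r(n)$), the diagonal power distortion is $D_n^r:[0,1]\to[0,1]$, $D_n^r(u)=\delta_n(u^{1/r_n})$. Generalized extreme value (GEV) distribution functions are $H_{\xi,\mu,\sigma}$ with $\xi,\mu\in\mathbb{R}$, $\sigma>0$: $H_{\xi,\mu,\sigma}(x)=\exp(-(1+\xi(x-\mu)/\sigma)^{-1/\xi})$ if $\xi\ne0$ and $\exp(-e^{-(x-\mu)/\sigma})$ if $\xi=0$, for all $x$ with $1+\xi(x-\mu)/\sigma>0$, and the corresponding limiting value $0$ or $1$ otherwise. $\lceil\cdot\rceil$ is the ceiling function. *)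

theory Defs
  imports "HOL-Probability.Probability" "HOL-Library.Landau_Symbols"
begin

text \<open>Sequences of random variables are indexed by the positive integers; the value of a
  sequence at index 0 is never used.\<close>

definition running_max :: "(nat \<Rightarrow> 'a \<Rightarrow> real) \<Rightarrow> nat \<Rightarrow> 'a \<Rightarrow> real" where
  "running_max X n \<omega> = Max ((\<lambda>i. X i \<omega>) ` {1..n})"

text \<open>When \<open>1 + \<xi> (x - \<mu>) / \<sigma> \<le> 0\<close>, the point \<open>x\<close> lies at or below the left endpoint of the support
  if \<open>\<xi> > 0\<close>, and at or above the right endpoint if \<open>\<xi> < 0\<close>.\<close>

definition gev_cdf :: "real \<Rightarrow> real \<Rightarrow> real \<Rightarrow> real \<Rightarrow> real" where
  "gev_cdf \<xi> \<mu> \<sigma> x =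
    (if \<xi> = 0 then exp (- exp (- ((x - \<mu>) / \<sigma>)))
     else if 1 + \<xi> * (x - \<mu>) / \<sigma> > 0 then exp (- ((1 + \<xi> * (x - \<mu>) / \<sigma>) powr (- 1 / \<xi>)))
     else if \<xi> > 0 then 0 else 1)"

definition distribution_function_on_unit :: "(real \<Rightarrow> real) \<Rightarrow> bool" where
  "distribution_function_on_unit D \<longleftrightarrow>
     mono_on {0..1} D \<and> (\<forall>u\<in>{0..<1}. continuous (at_right u) D) \<and> D 0 = 0 \<and> D 1 = 1"

text \<open>A copula in dimension \<open>n\<close> is the restriction to \<open>[0,1]\<^sup>n\<close> of the joint distribution function of
  a probability measure whose univariate margins are standard uniform. It is required to be
  extensional, i.e. \<open>undefined\<close> off \<open>[0,1]\<^sup>n\<close>, so that uniqueness of copulas is plain equality.\<close>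

definition copula :: "nat \<Rightarrow> ((nat \<Rightarrow> real) \<Rightarrow> real) \<Rightarrow> bool" where
  "copula n C \<longleftrightarrow>
     C \<in> extensional (PiE {1..n} (\<lambda>_. {0..1})) \<and>
     (\<exists>P. prob_space P \<and> sets P = sets (PiM {1..n} (\<lambda>_. borel)) \<and>
          (\<forall>i\<in>{1..n}. distr P borel (\<lambda>v. v i) = uniform_measure lborel {0..1}) \<and>
          (\<forall>u\<in>PiE {1..n} (\<lambda>_. {0..1}). C u = \<P>(v in P. \<forall>i\<in>{1..n}. v i \<le> u i)))"

definition is_copula_of ::
    "'a measure \<Rightarrow> (nat \<Rightarrow> 'a \<Rightarrow> real) \<Rightarrow> (real \<Rightarrow> real) \<Rightarrow> nat \<Rightarrow> ((nat \<Rightarrow> real) \<Rightarrow> real) \<Rightarrow> bool" where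
  "is_copula_of M X F n C \<longleftrightarrow> copula n C \<and>
     (\<forall>x :: nat \<Rightarrow> real.
        \<P>(\<omega> in M. \<forall>i\<in>{1..n}. X i \<omega> \<le> x i) = C (\<lambda>i\<in>{1..n}. F (x i)))"

text \<open>Existence and uniqueness, for continuous \<open>F\<close>, is \<open>ex1_copula_of\<close> below.\<close>

definition copula_of ::
    "'a measure \<Rightarrow> (nat \<Rightarrow> 'a \<Rightarrow> real) \<Rightarrow> (real \<Rightarrow> real) \<Rightarrow> nat \<Rightarrow> ((nat \<Rightarrow> real) \<Rightarrow> real)" where
  "copula_of M X F n = (THE C. is_copula_of M X F n C)"

definition copula_diagonal ::
    "'a measure \<Rightarrow> (nat \<Rightarrow> 'a \<Rightarrow> real) \<Rightarrow> (real \<Rightarrow> real) \<Rightarrow> nat \<Rightarrow> real \<Rightarrow> real" where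
  "copula_diagonal M X F n u = copula_of M X F n (\<lambda>i\<in>{1..n}. u)"

definition diagonal_power_distortion ::
    "'a measure \<Rightarrow> (nat \<Rightarrow> 'a \<Rightarrow> real) \<Rightarrow> (real \<Rightarrow> real) \<Rightarrow> (nat \<Rightarrow> real) \<Rightarrow> nat \<Rightarrow> real \<Rightarrow> real" where
  "diagonal_power_distortion M X F r n u = copula_diagonal M X F n (u powr (1 / r n))"

lemma cdf_range_interior:
  fixes F :: "real \<Rightarrow> real"
  assumes P: "prob_space M" and X: "X \<in> borel_measurable M"
    and F: "\<And>x. \<P>(\<omega> in M. X \<omega> \<le> x) = F x" and cont: "\<And>x. isCont F x" and a: "0 < a" "a < 1"
  shows "\<exists>x. F x = a"
proof -
  interpret prob_space M by fact
  interpret D: real_distribution "distr M borel X"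
    using X by (simp add: real_distribution_distr)
  have FD: "F = cdf (distr M borel X)"
    using X by (auto simp: fun_eq_iff cdf_def measure_distr F[symmetric] vimage_def Int_def conj_commute
        intro!: arg_cong[where f="measure M"])
  have 1: "(F \<longlongrightarrow> 0) at_bot" and 2: "(F \<longlongrightarrow> 1) at_top"
    unfolding FD by (rule D.cdf_lim_at_bot, rule D.cdf_lim_at_top_prob)
  obtain x1 where x1: "F x1 < a"
    using order_tendstoD(2)[OF 1 a(1)] eventually_happens'[OF trivial_limit_at_bot_linorder] by blast
  obtain x2 where x2: "a < F x2"
    using order_tendstoD(1)[OF 2 a(2)] eventually_happens'[OF trivial_limit_at_top_linorder] by blast
  have "mono F" unfolding FD by (auto intro!: monoI D.cdf_nondecreasing)
  hence "x1 \<le> x2" using x1 x2 by (metis linear monoD not_less order.trans less_le_trans)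
  thus ?thesis using IVT[of F x1 a x2] x1 x2 cont by force
qed

lemma prob_integral_transform:
  fixes F :: "real \<Rightarrow> real"
  assumes P: "prob_space M" and X: "X \<in> borel_measurable M"
    and F: "\<And>x. \<P>(\<omega> in M. X \<omega> \<le> x) = F x" and cont: "\<And>x. isCont F x" and a: "0 \<le> a" "a \<le> 1"
  shows "\<P>(\<omega> in M. F (X \<omega>) \<le> a) = a"
proof -
  interpret prob_space M by fact
  have [measurable]: "F \<in> borel_measurable borel"
    using cont by (simp add: borel_measurable_continuous_onI continuous_at_imp_continuous_on)
  note X[measurable]
  have mon: "F x \<le> F y" if "x \<le> y" for x y
    unfolding F[symmetric] using that by (intro finite_measure_mono) auto
  have low: "b \<le> \<P>(\<omega> in M. F (X \<omega>) \<le> a)" if b: "0 < b" "b < 1" "b \<le> a" for b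
  proof -
    obtain x where x: "F x = b" using cdf_range_interior[OF P X F cont b(1,2)] by blast
    have "b = \<P>(\<omega> in M. X \<omega> \<le> x)" using F x by simp
    also have "\<dots> \<le> \<P>(\<omega> in M. F (X \<omega>) \<le> a)"
      using mon x b by (intro finite_measure_mono) (auto intro: order_trans)
    finally show ?thesis .
  qed
  have upp: "\<P>(\<omega> in M. F (X \<omega>) \<le> a) \<le> b" if b: "0 < b" "b < 1" "a < b" for b
  proof -
    obtain x where x: "F x = b" using cdf_range_interior[OF P X F cont b(1,2)] by blast
    have "\<P>(\<omega> in M. F (X \<omega>) \<le> a) \<le> \<P>(\<omega> in M. X \<omega> \<le> x)"
    proof (rule finite_measure_mono)
      have "X \<omega> \<le> x" if "F (X \<omega>) \<le> a" for \<omega>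
        using mon[of x "X \<omega>"] that x b by linarith
      thus "{\<omega> \<in> space M. F (X \<omega>) \<le> a} \<subseteq> {\<omega> \<in> space M. X \<omega> \<le> x}" by blast
    qed simp
    also have "\<dots> = b" using F x by simp
    finally show ?thesis .
  qed
  show ?thesis
  proof (rule antisym)
    show "\<P>(\<omega> in M. F (X \<omega>) \<le> a) \<le> a"
    proof (cases "a = 1")
      case False
      show ?thesis by (rule dense_ge_bounded[of a 1]) (use a False upp in auto)
    qed simp
    show "a \<le> \<P>(\<omega> in M. F (X \<omega>) \<le> a)"
    proof (cases "a = 0")
      case False
      show ?thesis by (rule dense_le_bounded[of 0 a]) (use a False low in auto)
    qed simp
  qed
qed

lemma distr_eq_uniform:
  fixes Y :: "'a \<Rightarrow> real"
  assumes P: "prob_space M" and Y[measurable]: "Y \<in> borel_measurable M"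
    and U: "\<And>a. 0 \<le> a \<Longrightarrow> a \<le> 1 \<Longrightarrow> \<P>(\<omega> in M. Y \<omega> \<le> a) = a"
  shows "distr M borel Y = uniform_measure lborel {0..1::real}"
proof -
  interpret prob_space M by fact
  interpret D: real_distribution "distr M borel Y" by (simp add: real_distribution_distr)
  interpret V: prob_space "uniform_measure lborel {0..1::real}"
    by (rule prob_space_uniform_measure) auto
  have rd: "real_distribution (uniform_measure lborel {0..1::real})"
    by standard simp_all
  show ?thesis
  proof (rule cdf_unique[OF D.real_distribution_axioms rd], rule ext)
    fix x :: real
    have L: "cdf (distr M borel Y) x = \<P>(\<omega> in M. Y \<omega> \<le> x)"
      by (auto simp: cdf_def measure_distr intro!: arg_cong[where f="measure M"])
    have R: "cdf (uniform_measure lborel {0..1::real}) x = measure lborel ({0..1} \<inter> {..x})"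
      by (simp add: cdf_def measure_uniform_measure)
    consider "x < 0" | "0 \<le> x" "x \<le> 1" | "1 < x" by linarith
    thus "cdf (distr M borel Y) x = cdf (uniform_measure lborel {0..1::real}) x"
    proof cases
      case 1
      have "\<P>(\<omega> in M. Y \<omega> \<le> x) \<le> \<P>(\<omega> in M. Y \<omega> \<le> 0)"
        using 1 by (intro finite_measure_mono) auto
      also have "\<dots> = 0" using U[of 0] by simp
      finally have "\<P>(\<omega> in M. Y \<omega> \<le> x) = 0" by (simp add: measure_le_0_iff)
      moreover have "{0..1} \<inter> {..x} = {}" using 1 by auto
      ultimately show ?thesis by (simp add: L R)
    next
      case 2
      have "{0..1} \<inter> {..x} = {0..x}" using 2 by auto
      thus ?thesis using 2 U[of x] by (simp add: L R)
    next
      case 3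
      have "\<P>(\<omega> in M. Y \<omega> \<le> 1) \<le> \<P>(\<omega> in M. Y \<omega> \<le> x)"
        using 3 by (intro finite_measure_mono) auto
      hence "\<P>(\<omega> in M. Y \<omega> \<le> x) = 1" using U[of 1] by (simp add: antisym)
      moreover have "{0..1} \<inter> {..x} = {0..1}" using 3 by auto
      ultimately show ?thesis by (simp add: L R)
    qed
  qed
qed

lemma copula_lipschitz:
  assumes C: "copula n C" and u: "u \<in> PiE {1..n} (\<lambda>_. {0..1})" and w: "w \<in> PiE {1..n} (\<lambda>_. {0..1})"
  shows "C u \<le> C w + (\<Sum>i=1..n. \<bar>u i - w i\<bar>)"
proof -
  obtain P where P: "prob_space P" and sP: "sets P = sets (PiM {1..n} (\<lambda>_. borel))"
    and marg: "\<And>i. i \<in> {1..n} \<Longrightarrow> distr P borel (\<lambda>v. v i) = uniform_measure lborel {0..1::real}"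
    and eq: "\<And>u. u \<in> PiE {1..n} (\<lambda>_. {0..1}) \<Longrightarrow> C u = \<P>(v in P. \<forall>i\<in>{1..n}. v i \<le> u i)"
    using C unfolding copula_def by blast
  interpret prob_space P by fact
  have ms[measurable]: "(\<lambda>v. v i) \<in> borel_measurable P" if "i \<in> {1..n}" for i
    using that sP by (subst measurable_cong_sets[OF sP refl]) measurable
  have bd: "\<P>(v in P. w i < v i \<and> v i \<le> u i) \<le> \<bar>u i - w i\<bar>" if i: "i \<in> {1..n}" for i
  proof -
    note ms[OF i, measurable]
    have "\<P>(v in P. w i < v i \<and> v i \<le> u i) = measure (distr P borel (\<lambda>v. v i)) {w i<..u i}"
      by (auto simp: measure_distr intro!: arg_cong[where f="measure P"])
    also have "\<dots> = measure lborel ({0..1} \<inter> {w i<..u i})"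
      by (simp add: marg[OF i] measure_uniform_measure)
    also have "{0..1} \<inter> {w i<..u i} = {w i<..u i}"
      using PiE_mem[OF u i] PiE_mem[OF w i] by auto
    finally show ?thesis by (cases "w i \<le> u i") auto
  qed
  let ?A = "\<lambda>i. {v \<in> space P. w i < v i \<and> v i \<le> u i}"
  have m1: "{v \<in> space P. \<forall>i\<in>{1..n}. v i \<le> w i} \<in> sets P"
    by (intro sets.sets_Collect_finite_All) (auto intro!: borel_measurable_le ms)
  have m2: "?A i \<in> sets P" if "i \<in> {1..n}" for i
    using ms[OF that] by measurable
  have m3: "(\<Union>i\<in>{1..n}. ?A i) \<in> sets P" using m2 by blast
  have "C u = \<P>(v in P. \<forall>i\<in>{1..n}. v i \<le> u i)" by (rule eq[OF u])
  also have "\<dots> \<le> prob ({v \<in> space P. \<forall>i\<in>{1..n}. v i \<le> w i} \<union> (\<Union>i\<in>{1..n}. ?A i))"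
    using m1 m3 by (intro finite_measure_mono) (auto simp: not_le)
  also have "\<dots> \<le> prob {v \<in> space P. \<forall>i\<in>{1..n}. v i \<le> w i} + prob (\<Union>i\<in>{1..n}. ?A i)"
    using m1 m3 by (rule measure_Un_le)
  also have "prob (\<Union>i\<in>{1..n}. ?A i) \<le> (\<Sum>i=1..n. prob (?A i))"
    using m2 by (intro finite_measure_subadditive_finite) auto
  also have "\<dots> \<le> (\<Sum>i=1..n. \<bar>u i - w i\<bar>)" using bd by (intro sum_mono) auto
  finally show ?thesis using eq[OF w] by simp
qed

lemma ex1_copula_of:
  fixes F :: "real \<Rightarrow> real"
  assumes P: "prob_space M" and X: "\<And>i. i \<ge> 1 \<Longrightarrow> X i \<in> borel_measurable M"
    and F: "\<And>i x. i \<ge> 1 \<Longrightarrow> \<P>(\<omega> in M. X i \<omega> \<le> x) = F x" and cont: "\<And>x. isCont F x"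
  shows "\<exists>!C. is_copula_of M X F n C"
proof (rule ex_ex1I)
  interpret prob_space M by fact
  let ?I = "{1..n}" and ?Q = "PiE {1..n} (\<lambda>_. {0..1::real})"
  have Fm[measurable]: "F \<in> borel_measurable borel"
    using cont by (simp add: borel_measurable_continuous_onI continuous_at_imp_continuous_on)
  have Xm[measurable]: "X i \<in> borel_measurable M" if "i \<in> ?I" for i using X that by simp
  define T where "T = (\<lambda>\<omega>. \<lambda>i\<in>?I. F (X i \<omega>))"
  have FXm[measurable]: "(\<lambda>\<omega>. F (X i \<omega>)) \<in> borel_measurable M" if "i \<in> ?I" for i
    using Xm[OF that] Fm by measurable
  have T[measurable]: "T \<in> measurable M (PiM ?I (\<lambda>_. borel))"
    unfolding T_def by (rule measurable_restrict) (rule FXm)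
  define P where "P = distr M (PiM ?I (\<lambda>_. borel)) T"
  define C where "C = restrict (\<lambda>u. \<P>(v in P. \<forall>i\<in>?I. v i \<le> u i)) ?Q"
  have bx: "{v \<in> space (PiM ?I (\<lambda>_. borel)). \<forall>i\<in>?I. v i \<le> (u i :: real)} \<in> sets (PiM ?I (\<lambda>_. borel))" for u
    by (intro sets.sets_Collect_finite_All) (auto intro!: borel_measurable_le measurable_component_singleton)
  have PC: "\<P>(v in P. \<forall>i\<in>?I. v i \<le> u i) = \<P>(\<omega> in M. \<forall>i\<in>?I. F (X i \<omega>) \<le> u i)" for u
    unfolding P_def using bx[of u] T measurable_space[OF T]
    by (subst measure_distr) (auto simp: T_def intro!: arg_cong[where f="measure M"])
  have F01: "0 \<le> F x" "F x \<le> 1" for x unfolding F[of 1, OF order.refl, symmetric] by auto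
  have mon: "F x \<le> F y" if "x \<le> y" for x y
    unfolding F[of 1, OF order.refl, symmetric] using that X[of 1] by (intro finite_measure_mono) auto
  have "copula n C"
    unfolding copula_def
  proof (intro conjI exI[of _ P] ballI)
    show "C \<in> extensional ?Q" by (simp add: C_def)
    show "prob_space P" unfolding P_def by (rule prob_space_distr) (rule T)
    show "sets P = sets (PiM ?I (\<lambda>_. borel))" by (simp add: P_def)
    fix i assume i: "i \<in> ?I"
    have "distr P borel (\<lambda>v. v i) = distr M borel (\<lambda>\<omega>. F (X i \<omega>))"
      unfolding P_def using i
      by (subst distr_distr) (auto simp: comp_def T_def intro!: measurable_component_singleton T[unfolded T_def])
    also have "\<dots> = uniform_measure lborel {0..1}"
    proof (rule distr_eq_uniform[OF P FXm[OF i]])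
      fix a :: real assume a: "0 \<le> a" "a \<le> 1"
      show "\<P>(\<omega> in M. F (X i \<omega>) \<le> a) = a"
        by (rule prob_integral_transform[OF P Xm[OF i] _ cont a]) (use i F in auto)
    qed
    finally show "distr P borel (\<lambda>v. v i) = uniform_measure lborel {0..1}" .
  next
    fix u assume "u \<in> ?Q"
    thus "C u = \<P>(v in P. \<forall>i\<in>?I. v i \<le> u i)" by (simp add: C_def)
  qed
  moreover have "\<P>(\<omega> in M. \<forall>i\<in>?I. X i \<omega> \<le> x i) = C (\<lambda>i\<in>?I. F (x i))" for x
  proof -
    have nul: "AE \<omega> in M. F (X i \<omega>) \<le> F (x i) \<longrightarrow> X i \<omega> \<le> x i" if i: "i \<in> ?I" for i
    proof -
      note Xm[OF i, measurable] 
      have e: "\<P>(\<omega> in M. F (X i \<omega>) \<le> F (x i)) = F (x i)"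
        by (rule prob_integral_transform[OF P Xm[OF i] _ cont F01]) (use i F in auto)
      have "prob ({\<omega>\<in>space M. F (X i \<omega>) \<le> F (x i)} - {\<omega>\<in>space M. X i \<omega> \<le> x i}) = 0"
        using e F[of i "x i"] i mon by (subst finite_measure_Diff) auto
      moreover have "{\<omega>\<in>space M. F (X i \<omega>) \<le> F (x i)} - {\<omega>\<in>space M. X i \<omega> \<le> x i}
          = {\<omega>\<in>space M. \<not> (F (X i \<omega>) \<le> F (x i) \<longrightarrow> X i \<omega> \<le> x i)}" by auto
      ultimately show ?thesis
        by (subst AE_iff_measurable[OF _ refl]) (auto simp: emeasure_eq_measure)
    qed
    have "AE \<omega> in M. \<forall>i\<in>?I. F (X i \<omega>) \<le> F (x i) \<longrightarrow> X i \<omega> \<le> x i"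
      using nul by (subst AE_finite_all) auto
    hence "AE \<omega> in M. (\<forall>i\<in>?I. X i \<omega> \<le> x i) \<longleftrightarrow> (\<forall>i\<in>?I. F (X i \<omega>) \<le> F (x i))"
      by eventually_elim (use mon in blast)
    moreover have "{\<omega> \<in> space M. \<forall>i\<in>?I. X i \<omega> \<le> x i} \<in> sets M"
      by (intro sets.sets_Collect_finite_All) (auto intro!: borel_measurable_le Xm)
    moreover have "{\<omega> \<in> space M. \<forall>i\<in>?I. F (X i \<omega>) \<le> F (x i)} \<in> sets M"
      by (intro sets.sets_Collect_finite_All) (auto intro!: borel_measurable_le FXm)
    ultimately have "\<P>(\<omega> in M. \<forall>i\<in>?I. X i \<omega> \<le> x i) = \<P>(\<omega> in M. \<forall>i\<in>?I. F (X i \<omega>) \<le> F (x i))"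
      by (intro finite_measure_eq_AE) auto
    also have "\<dots> = \<P>(\<omega> in M. \<forall>i\<in>?I. F (X i \<omega>) \<le> (\<lambda>i\<in>?I. F (x i)) i)" by simp
    also have "\<dots> = C (\<lambda>i\<in>?I. F (x i))"
    proof -
      have "(\<lambda>i\<in>?I. F (x i)) \<in> ?Q" using F01 by (auto simp: PiE_iff)
      thus ?thesis unfolding C_def by (simp only: restrict_apply' PC)
    qed
    finally show ?thesis .
  qed
  ultimately show "\<exists>C. is_copula_of M X F n C" unfolding is_copula_of_def by blast
next
  let ?I = "{1..n}" and ?Q = "PiE {1..n} (\<lambda>_. {0..1::real})"
  have agree: "C u \<le> C' u" if CC: "is_copula_of M X F n C" "is_copula_of M X F n C'" and u: "u \<in> ?Q" for C C' u
  proof (rule field_le_epsilon)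
    fix e :: real assume e: "e > 0"
    define d where "d = min (1/4) (e / (2 * (real n + 1)))"
    have d: "0 < d" "d \<le> 1/4"
      unfolding d_def using e by simp (rule min.cobounded1)
    have nd: "2 * (real n * d) \<le> e"
    proof -
      have "d \<le> e / (2 * (real n + 1))" unfolding d_def by (rule min.cobounded2)
      hence "d * (2 * (real n + 1)) \<le> e" by (simp add: pos_le_divide_eq)
      thus ?thesis using d by (simp add: algebra_simps)
    qed
    define w where "w = (\<lambda>i\<in>?I. max d (min (1 - d) (u i)))"
    have w01: "0 < w i" "w i < 1" "\<bar>u i - w i\<bar> \<le> d" "\<bar>w i - u i\<bar> \<le> d" if "i \<in> ?I" for i
      using that d u by (auto simp: w_def PiE_iff max_def min_def abs_if)
    have wQ: "w \<in> ?Q" using w01 by (auto simp: PiE_iff w_def less_imp_le extensional_def)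
    have "\<forall>i\<in>?I. \<exists>x. F x = w i"
      using w01 cdf_range_interior[OF P X F cont] by auto
    then obtain x where x: "\<And>i. i \<in> ?I \<Longrightarrow> F (x i) = w i" by metis
    have "w = (\<lambda>i\<in>?I. F (x i))" using x by (auto simp: w_def fun_eq_iff)
    hence eqw: "C w = C' w" using CC unfolding is_copula_of_def by metis
    have "C u \<le> C w + (\<Sum>i=1..n. \<bar>u i - w i\<bar>)"
      using CC(1) u wQ by (intro copula_lipschitz) (auto simp: is_copula_of_def)
    also have "C w = C' w" by (rule eqw)
    also have "C' w \<le> C' u + (\<Sum>i=1..n. \<bar>w i - u i\<bar>)"
      using CC(2) u wQ by (intro copula_lipschitz) (auto simp: is_copula_of_def)
    finally have "C u \<le> C' u + (\<Sum>i=1..n. \<bar>w i - u i\<bar>) + (\<Sum>i=1..n. \<bar>u i - w i\<bar>)" by simp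
    moreover have "(\<Sum>i=1..n. \<bar>w i - u i\<bar>) \<le> real n * d" "(\<Sum>i=1..n. \<bar>u i - w i\<bar>) \<le> real n * d"
      using w01 sum_bounded_above[of ?I "\<lambda>i. \<bar>w i - u i\<bar>" d] sum_bounded_above[of ?I "\<lambda>i. \<bar>u i - w i\<bar>" d]
      by auto
    ultimately show "C u \<le> C' u + e" using nd by simp
  qed
  fix C C' assume CC: "is_copula_of M X F n C" "is_copula_of M X F n C'"
  show "C = C'"
  proof (rule extensionalityI[of _ ?Q])
    show "C \<in> extensional ?Q" "C' \<in> extensional ?Q" using CC by (auto simp: is_copula_of_def copula_def)
    show "C u = C' u" if "u \<in> ?Q" for u using agree[OF CC that] agree[OF CC(2,1) that] by simp
  qed
qed

end

theory Submission
  imports Defs "HOL-Real_Asymp.Real_Asymp"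
begin

text \<open>With \<open>k = \<lceil>r\<^sub>n\<rceil>\<close> and \<open>y = c\<^sub>k x + d\<^sub>k\<close>, the distribution function of the rescaled maximum at
  \<open>x\<close> is \<open>D\<^sub>n\<^sup>r (v\<^sub>n)\<close> for \<open>v\<^sub>n = F(y)\<^bsup>r\<^sub>n\<^esup> = (F(y)\<^bsup>k\<^esup>)\<^bsup>r\<^sub>n/k\<^esup>\<close>, and \<open>v\<^sub>n\<close> tends to \<open>H x\<close> since
  \<open>r\<^sub>n / k\<close> tends to 1. As each \<open>D\<^sub>n\<^sup>r\<close> is monotone, pointwise convergence of \<open>D\<^sub>n\<^sup>r\<close> to a continuous limit
  can be evaluated along \<open>v\<^sub>n\<close>. Conversely, \<open>D\<^sub>n\<^sup>r(u)\<close> is squeezed between its values along sequences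
  \<open>v\<^sub>n\<close> tending to continuity points of \<open>D\<close> slightly below and above \<open>u\<close>; every point of \<open>(0,1)\<close>
  is a value of \<open>H\<close>.\<close>

section \<open>Generalized extreme value distribution functions\<close>

lemma gev_cdf_in_unit: "gev_cdf \<xi> \<mu> \<sigma> x \<in> {0..1}"
  by (auto simp: gev_cdf_def)

text \<open>The witness comes from inverting the explicit formula of \<open>gev_cdf\<close>.
  Continuity at the preimage is recorded as well, because part (ii) assumes convergence only at
  continuity points of \<open>D \<circ> H\<close>.\<close>

lemma gev_cdf_attains:
  assumes \<sigma>: "\<sigma> > 0" and u: "0 < u" "u < 1"
  obtains x where "gev_cdf \<xi> \<mu> \<sigma> x = u" "isCont (gev_cdf \<xi> \<mu> \<sigma>) x"
proof (cases "\<xi> = 0")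
  case True
  let ?x = "\<mu> - \<sigma> * ln (- ln u)"
  have "gev_cdf \<xi> \<mu> \<sigma> ?x = u"
    using u \<sigma> True by (simp add: gev_cdf_def)
  moreover have "isCont (gev_cdf \<xi> \<mu> \<sigma>) ?x"
    using \<sigma> True by (simp add: gev_cdf_def[abs_def])
  ultimately show ?thesis by (rule that)
next
  case False
  let ?x = "\<mu> + \<sigma> * ((- ln u) powr (- \<xi>) - 1) / \<xi>"
  have arg: "1 + \<xi> * (?x - \<mu>) / \<sigma> = (- ln u) powr (- \<xi>)"
    using False \<sigma> by (simp add: field_simps)
  have pos: "1 + \<xi> * (?x - \<mu>) / \<sigma> > 0"
    unfolding arg using u by simp
  have "gev_cdf \<xi> \<mu> \<sigma> ?x = exp (- (((- ln u) powr (- \<xi>)) powr (- 1 / \<xi>)))"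
    unfolding gev_cdf_def using False pos by (simp only: arg if_False if_True)
  also have "\<dots> = u"
    using False u by (simp add: powr_powr)
  finally have eq: "gev_cdf \<xi> \<mu> \<sigma> ?x = u" .
  \<comment> \<open>Positivity of the base is an open condition, so the exponential branch of
    \<open>gev_cdf\<close> is the active one on a whole neighbourhood of \<open>?x\<close>, and
    continuity can be checked on that formula.\<close>
  have lim: "((\<lambda>z. 1 + \<xi> * (z - \<mu>) / \<sigma>) \<longlongrightarrow> 1 + \<xi> * (?x - \<mu>) / \<sigma>) (nhds ?x)"
    by (intro tendsto_intros filterlim_ident) (use \<sigma> in auto)
  have ev: "\<forall>\<^sub>F z in nhds ?x. gev_cdf \<xi> \<mu> \<sigma> z = exp (- ((1 + \<xi> * (z - \<mu>) / \<sigma>) powr (- 1 / \<xi>)))"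
    using order_tendstoD(1)[OF lim pos]
    by eventually_elim (use False in \<open>simp add: gev_cdf_def\<close>)
  have "isCont (\<lambda>z. exp (- ((1 + \<xi> * (z - \<mu>) / \<sigma>) powr (- 1 / \<xi>)))) ?x"
    using pos \<sigma> by (intro continuous_intros) auto
  hence "isCont (gev_cdf \<xi> \<mu> \<sigma>) ?x"
    using isCont_cong[OF ev] by simp
  with eq show ?thesis by (rule that)
qed

section \<open>Maxima and copula diagonals\<close>

lemma running_max_le_iff: "n \<ge> 1 \<Longrightarrow> running_max X n \<omega> \<le> y \<longleftrightarrow> (\<forall>i\<in>{1..n}. X i \<omega> \<le> y)"
  by (auto simp: running_max_def)

lemma copula_diag_mono:
  assumes C: "copula n C" and "0 \<le> u" "u \<le> v" "v \<le> 1"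
  shows "C (\<lambda>i\<in>{1..n}. u) \<le> C (\<lambda>i\<in>{1..n}. v)"
proof -
  obtain P where P: "prob_space P" and sP: "sets P = sets (PiM {1..n} (\<lambda>_. borel))"
    and eq: "\<And>u. u \<in> PiE {1..n} (\<lambda>_. {0..1}) \<Longrightarrow> C u = \<P>(v in P. \<forall>i\<in>{1..n}. v i \<le> u i)"
    using C unfolding copula_def by blast
  interpret prob_space P by fact
  have ms: "(\<lambda>v. v i) \<in> borel_measurable P" if "i \<in> {1..n}" for i
    using that by (subst measurable_cong_sets[OF sP refl]) measurable
  have "{w \<in> space P. \<forall>i\<in>{1..n}. w i \<le> v} \<in> sets P"
    by (intro sets.sets_Collect_finite_All) (auto intro!: borel_measurable_le ms)
  hence "\<P>(w in P. \<forall>i\<in>{1..n}. w i \<le> u) \<le> \<P>(w in P. \<forall>i\<in>{1..n}. w i \<le> v)"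
    using assms by (intro finite_measure_mono) (auto intro: order_trans)
  thus ?thesis using assms by (subst (1 2) eq) auto
qed

text \<open>A uniform margin gives no mass to the half-line up to 0 and full mass to the half-line
  up to 1. For the value 0 a single margin suffices, and \<open>n \<ge> 1\<close> provides one: in
  dimension 0 the condition is vacuous and the probability would be 1. For the value 1 finitely many
  almost sure events are intersected.\<close>

lemma copula_diag_0_1:
  assumes C: "copula n C" and n: "n \<ge> 1"
  shows "C (\<lambda>i\<in>{1..n}. 0) = 0" and "C (\<lambda>i\<in>{1..n}. 1) = 1"
proof -
  obtain P where P: "prob_space P" and sP: "sets P = sets (PiM {1..n} (\<lambda>_. borel))"
    and marg: "\<And>i. i \<in> {1..n} \<Longrightarrow> distr P borel (\<lambda>v. v i) = uniform_measure lborel {0..1::real}"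
    and eq: "\<And>u. u \<in> PiE {1..n} (\<lambda>_. {0..1}) \<Longrightarrow> C u = \<P>(v in P. \<forall>i\<in>{1..n}. v i \<le> u i)"
    using C unfolding copula_def by blast
  interpret prob_space P by fact
  have ms: "(\<lambda>v. v i) \<in> borel_measurable P" if "i \<in> {1..n}" for i
    using that by (subst measurable_cong_sets[OF sP refl]) measurable
  have one: "\<P>(v in P. v i \<le> a) = measure lborel ({0..1} \<inter> {..a})" if i: "i \<in> {1..n}" for i a
  proof -
    have "\<P>(v in P. v i \<le> a) = measure (distr P borel (\<lambda>v. v i)) {..a}"
      using ms[OF i] by (auto simp: measure_distr intro!: arg_cong[where f="measure P"])
    thus ?thesis by (simp add: marg[OF i] measure_uniform_measure)
  qed
  have 1: "1 \<in> {1..n}" using n by simp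
  have "{0..1} \<inter> {..0} = {0::real}" by auto
  hence "\<P>(v in P. v 1 \<le> 0) = 0" using one[OF 1, of 0] by simp
  moreover have "\<P>(v in P. \<forall>i\<in>{1..n}. v i \<le> 0) \<le> \<P>(v in P. v 1 \<le> 0)"
  proof (rule finite_measure_mono)
    show "{v \<in> space P. v 1 \<le> 0} \<in> sets P" using ms[OF 1] by measurable
  qed (use 1 in auto)
  ultimately have "\<P>(v in P. \<forall>i\<in>{1..n}. v i \<le> 0) = 0"
    by (simp add: measure_le_0_iff)
  thus "C (\<lambda>i\<in>{1..n}. 0) = 0" by (subst eq) auto
  have "AE v in P. v i \<le> 1" if i: "i \<in> {1..n}" for i
  proof (subst prob_Collect_eq_1[symmetric])
    show "{v \<in> space P. v i \<le> 1} \<in> sets P" using ms[OF i] by measurable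
    show "\<P>(v in P. v i \<le> 1) = 1" using one[OF i, of 1] by (simp add: Int_absorb2)
  qed
  hence "AE v in P. \<forall>i\<in>{1..n}. v i \<le> 1" by (subst AE_finite_all) auto
  moreover have "{v \<in> space P. \<forall>i\<in>{1..n}. v i \<le> 1} \<in> sets P"
    by (intro sets.sets_Collect_finite_All) (auto intro!: borel_measurable_le ms)
  ultimately have "\<P>(v in P. \<forall>i\<in>{1..n}. v i \<le> 1) = 1"
    by (subst prob_Collect_eq_1) auto
  thus "C (\<lambda>i\<in>{1..n}. 1) = 1" by (subst eq) auto
qed

lemma prob_running_max_iid:
  fixes X :: "nat \<Rightarrow> 'a \<Rightarrow> real"
  assumes M: "prob_space M" and ind: "prob_space.indep_vars M (\<lambda>_. borel) X {1..}"
    and F: "\<And>i. i \<ge> 1 \<Longrightarrow> cdf (distr M borel (X i)) = F" and n: "n \<ge> 1"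
  shows "\<P>(\<omega> in M. running_max X n \<omega> \<le> y) = F y ^ n"
proof -
  interpret prob_space M by fact
  have Xm: "X i \<in> borel_measurable M" if "i \<ge> 1" for i
    using ind that unfolding indep_vars_def by auto
  have "{\<omega> \<in> space M. running_max X n \<omega> \<le> y} = (\<Inter>i\<in>{1..n}. X i -` {..y} \<inter> space M)"
    using n by (auto simp: running_max_le_iff)
  also have "prob \<dots> = (\<Prod>i\<in>{1..n}. prob (X i -` {..y} \<inter> space M))"
    using n by (intro indep_varsD[OF ind]) auto
  also have "\<dots> = (\<Prod>i\<in>{1..n}. F y)"
  proof (rule prod.cong)
    fix i assume "i \<in> {1..n}"
    hence i: "i \<ge> 1" by simp
    show "prob (X i -` {..y} \<inter> space M) = F y"
      unfolding F[OF i, symmetric] using Xm[OF i] by (simp add: cdf_def measure_distr)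
  qed simp
  finally show ?thesis by simp
qed

section \<open>Limits of monotone functions and of powers\<close>

lemma tendsto_along_mono:
  fixes G :: "nat \<Rightarrow> real \<Rightarrow> real"
  assumes mono: "\<And>n. n \<ge> 1 \<Longrightarrow> mono_on {0..1} (G n)"
    and lim: "\<And>u. u \<in> {0..1} \<Longrightarrow> (\<lambda>n. G n u) \<longlonglongrightarrow> D u"
    and cont: "continuous_on {0..1} D"
    and v: "v \<longlonglongrightarrow> a" and v01: "\<And>n. n \<ge> 1 \<Longrightarrow> v n \<in> {0..1}" and a: "a \<in> {0..1}"
  shows "(\<lambda>n. G n (v n)) \<longlonglongrightarrow> D a"
proof (rule order_tendstoI)
  have Da: "(D \<longlongrightarrow> D a) (at a within {0..1})"
    using cont a by (simp add: continuous_on)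
  fix l assume l: "l < D a"
  obtain e where e: "e > 0" "\<And>z. z \<in> {0..1} \<Longrightarrow> dist z a < e \<Longrightarrow> l < D z"
    using order_tendstoD(1)[OF Da l] l unfolding eventually_at by (metis)
  \<comment> \<open>A fixed comparison point that \<open>v\<close> eventually exceeds: half the
    radius keeps it strictly within \<open>e\<close> of \<open>a\<close>. Truncation at 0 keeps it
    in the unit interval and does not spoil \<open>b \<le> v n\<close>, since
    \<open>v n \<ge> 0\<close>. The upper bound below mirrors this with truncation at 1.\<close>
  define b where "b = max 0 (a - e / 2)"
  have b: "b \<in> {0..1}" "l < D b"
    using a e(1) by (auto simp: b_def dist_real_def intro!: e(2))
  have "\<forall>\<^sub>F n in sequentially. a - e / 2 < v n"
    using e(1) by (intro order_tendstoD(1)[OF v]) auto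
  with eventually_ge_at_top[of 1] order_tendstoD(1)[OF lim[OF b(1)] b(2)]
  show "\<forall>\<^sub>F n in sequentially. l < G n (v n)"
  proof eventually_elim
    case (elim n)
    hence "b \<le> v n" using v01[of n] by (auto simp: b_def)
    hence "G n b \<le> G n (v n)"
      using mono_onD[OF mono] elim b(1) v01[of n] by blast
    thus ?case using elim by simp
  qed
next
  have Da: "(D \<longlongrightarrow> D a) (at a within {0..1})"
    using cont a by (simp add: continuous_on)
  fix l assume l: "D a < l"
  obtain e where e: "e > 0" "\<And>z. z \<in> {0..1} \<Longrightarrow> dist z a < e \<Longrightarrow> D z < l"
    using order_tendstoD(2)[OF Da l] l unfolding eventually_at by (metis)
  define b where "b = min 1 (a + e / 2)"
  have b: "b \<in> {0..1}" "D b < l"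
    using a e(1) by (auto simp: b_def dist_real_def intro!: e(2))
  have "\<forall>\<^sub>F n in sequentially. v n < a + e / 2"
    using e(1) by (intro order_tendstoD(2)[OF v]) auto
  with eventually_ge_at_top[of 1] order_tendstoD(2)[OF lim[OF b(1)] b(2)]
  show "\<forall>\<^sub>F n in sequentially. G n (v n) < l"
  proof eventually_elim
    case (elim n)
    hence "v n \<le> b" using v01[of n] by (auto simp: b_def)
    hence "G n (v n) \<le> G n b"
      using mono_onD[OF mono] elim b(1) v01[of n] by blast
    thus ?case using elim by simp
  qed
qed

text \<open>A monotone function has only countably many discontinuities, whereas a nonempty open
  interval is uncountable.\<close>

lemma mono_on_isCont_dense:
  fixes D :: "real \<Rightarrow> real"
  assumes "mono_on {a<..<b} D" "a < b"
  obtains w where "a < w" "w < b" "isCont D w"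
proof -
  have "countable {w \<in> {a<..<b}. \<not> continuous (at w within {a<..<b}) D}"
    by (rule mono_on_ctble_discont) fact
  moreover have "uncountable {a<..<b}" using assms(2) by (simp add: uncountable_open_interval)
  ultimately have "\<not> {a<..<b} \<subseteq> {w \<in> {a<..<b}. \<not> continuous (at w within {a<..<b}) D}"
    using countable_subset by blast
  then obtain w where "w \<in> {a<..<b}" "continuous (at w within {a<..<b}) D" by blast
  thus ?thesis using that by (auto simp: at_within_open[of w "{a<..<b}"])
qed

text \<open>Nothing is assumed about \<open>G n\<close> at a fixed argument: \<open>seq\<close>
  gives the limit only along some moving sequence for each continuity point. If that point
  \<open>w\<close> lies strictly below \<open>u\<close>, the sequence eventually does too, so
  monotonicity bounds \<open>G n u\<close> from below. Points above \<open>u\<close> give the upper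
  bound.\<close>

lemma tendsto_at_isCont_mono:
  fixes G :: "nat \<Rightarrow> real \<Rightarrow> real"
  assumes mono: "\<And>n. n \<ge> 1 \<Longrightarrow> mono_on {0..1} (G n)" and D: "mono_on {0..1} D"
    and seq: "\<And>w. 0 < w \<Longrightarrow> w < 1 \<Longrightarrow> isCont D w \<Longrightarrow>
        \<exists>v. v \<longlonglongrightarrow> w \<and> (\<forall>n\<ge>1. v n \<in> {0..1}) \<and> (\<lambda>n. G n (v n)) \<longlonglongrightarrow> D w"
    and u: "0 < u" "u < 1" "isCont D u"
  shows "(\<lambda>n. G n u) \<longlonglongrightarrow> D u"
proof (rule order_tendstoI)
  have Du: "(D \<longlongrightarrow> D u) (at u)" using u(3) by (simp add: isCont_def)
  fix l assume l: "l < D u"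
  obtain e where e: "e > 0" "\<And>z. dist z u < e \<Longrightarrow> l < D z"
    using order_tendstoD(1)[OF Du l] l unfolding eventually_at by (metis UNIV_I)
  \<comment> \<open>Truncating the interval at 0 makes the chosen \<open>w\<close> an interior point
    of the unit interval, as \<open>seq\<close> requires.\<close>
  have "mono_on {max 0 (u - e)<..<u} D" by (rule mono_on_subset[OF D]) (use u in auto)
  then obtain w where w: "max 0 (u - e) < w" "w < u" "isCont D w"
    by (rule mono_on_isCont_dense) (use u e in auto)
  obtain v where v: "v \<longlonglongrightarrow> w" "\<forall>n\<ge>1. v n \<in> {0..1}" "(\<lambda>n. G n (v n)) \<longlonglongrightarrow> D w"
    using seq[of w] w u by auto
  have "l < D w" using w by (intro e(2)) (auto simp: dist_real_def)
  from eventually_ge_at_top[of 1] order_tendstoD(1)[OF v(3) this] order_tendstoD(2)[OF v(1) w(2)]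
  show "\<forall>\<^sub>F n in sequentially. l < G n u"
  proof eventually_elim
    case (elim n)
    hence "G n (v n) \<le> G n u"
      using u v(2) by (intro mono_onD[OF mono]) auto
    thus ?case using elim by simp
  qed
next
  have Du: "(D \<longlongrightarrow> D u) (at u)" using u(3) by (simp add: isCont_def)
  fix l assume l: "D u < l"
  obtain e where e: "e > 0" "\<And>z. dist z u < e \<Longrightarrow> D z < l"
    using order_tendstoD(2)[OF Du l] l unfolding eventually_at by (metis UNIV_I)
  have "mono_on {u<..<min 1 (u + e)} D" by (rule mono_on_subset[OF D]) (use u in auto)
  then obtain w where w: "u < w" "w < min 1 (u + e)" "isCont D w"
    by (rule mono_on_isCont_dense) (use u e in auto)
  obtain v where v: "v \<longlonglongrightarrow> w" "\<forall>n\<ge>1. v n \<in> {0..1}" "(\<lambda>n. G n (v n)) \<longlonglongrightarrow> D w"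
    using seq[of w] w u by auto
  have "D w < l" using w by (intro e(2)) (auto simp: dist_real_def)
  from eventually_ge_at_top[of 1] order_tendstoD(2)[OF v(3) this] order_tendstoD(1)[OF v(1) w(1)]
  show "\<forall>\<^sub>F n in sequentially. G n u < l"
  proof eventually_elim
    case (elim n)
    hence "G n u \<le> G n (v n)"
      using u v(2) by (intro mono_onD[OF mono]) auto
    thus ?case using elim by simp
  qed
qed

text \<open>With \<open>k = nat \<lceil>r n\<rceil>\<close>, write \<open>q k powr r n\<close> as
  \<open>(q k ^ k) powr (r n / k)\<close>. The base tends to \<open>h\<close> along the subsequence
  of indices \<open>k\<close>, and the exponent tends to 1.\<close>

lemma tendsto_power_to_powr_rate:
  fixes q :: "nat \<Rightarrow> real" and r :: "nat \<Rightarrow> real"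
  assumes q: "\<And>k. q k \<ge> 0" and lim: "(\<lambda>k. q k ^ k) \<longlonglongrightarrow> h"
    and r: "filterlim r at_top sequentially"
  shows "(\<lambda>n. q (nat \<lceil>r n\<rceil>) powr r n) \<longlonglongrightarrow> h"
proof -
  have "filterlim (\<lambda>x::real. nat \<lceil>x\<rceil>) sequentially at_top"
    by real_asymp
  hence "filterlim (\<lambda>n. nat \<lceil>r n\<rceil>) sequentially sequentially"
    by (rule filterlim_compose[OF _ r])
  hence 1: "(\<lambda>n. q (nat \<lceil>r n\<rceil>) ^ nat \<lceil>r n\<rceil>) \<longlonglongrightarrow> h"
    by (rule filterlim_compose[OF lim])
  have "((\<lambda>x::real. x / real_of_int \<lceil>x\<rceil>) \<longlongrightarrow> 1) at_top" by real_asymp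
  hence 2: "(\<lambda>n. r n / real_of_int \<lceil>r n\<rceil>) \<longlonglongrightarrow> 1"
    by (rule filterlim_compose[OF _ r])
  \<comment> \<open>The limit \<open>h\<close> may be 0, as happens for \<open>H\<close> to the left
    of its support. The power is still continuous there, because the bases are nonnegative and the
    limiting exponent 1 is positive.\<close>
  have "(\<lambda>n. (q (nat \<lceil>r n\<rceil>) ^ nat \<lceil>r n\<rceil>) powr (r n / real_of_int \<lceil>r n\<rceil>)) \<longlonglongrightarrow> h powr 1"
    using 1 2 q by (intro tendsto_powr') auto
  moreover have "h \<ge> 0" by (rule LIMSEQ_le_const[OF lim]) (use q in auto)
  moreover have "\<forall>\<^sub>F n in sequentially. 0 < r n"
    using r by (simp add: filterlim_at_top_dense)
  hence "\<forall>\<^sub>F n in sequentially. (q (nat \<lceil>r n\<rceil>) ^ nat \<lceil>r n\<rceil>) powr (r n / real_of_int \<lceil>r n\<rceil>)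
      = q (nat \<lceil>r n\<rceil>) powr r n"
  proof eventually_elim
    case (elim n)
    hence k: "nat \<lceil>r n\<rceil> > 0" "real (nat \<lceil>r n\<rceil>) = real_of_int \<lceil>r n\<rceil>" "\<lceil>r n\<rceil> \<noteq> 0"
      by linarith+
    show ?case
    \<comment> \<open>The power laws used here need a positive base. For base 0 both sides are 0,
      since the integer exponent is positive.\<close>
    proof (cases "q (nat \<lceil>r n\<rceil>) = 0")
      case False
      hence "q (nat \<lceil>r n\<rceil>) > 0" using q[of "nat \<lceil>r n\<rceil>"] by simp
      thus ?thesis using k by (simp add: powr_realpow[symmetric] powr_powr)
    qed (use k in simp)
  qed
  ultimately show ?thesis using Lim_transform_eventually by fastforce
qed

section \<open>Both implications between convergence of distortions and of maxima\<close>

theorem theorem2p2: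
  fixes M :: "'a measure" and X :: "nat \<Rightarrow> 'a \<Rightarrow> real"
    and M' :: "'b measure" and X' :: "nat \<Rightarrow> 'b \<Rightarrow> real"
    and F H :: "real \<Rightarrow> real" and \<xi> \<mu> \<sigma> :: real and c d :: "nat \<Rightarrow> real"
  assumes "prob_space M"
    and "\<And>i. i \<ge> 1 \<Longrightarrow> X i \<in> borel_measurable M"
    and "\<And>i. i \<ge> 1 \<Longrightarrow> cdf (distr M borel (X i)) = F"
    and "continuous_on UNIV F"
    and "prob_space M'"
    and "prob_space.indep_vars M' (\<lambda>_. borel) X' {1..}"
    and "\<And>i. i \<ge> 1 \<Longrightarrow> cdf (distr M' borel (X' i)) = F"
    and "\<sigma> > 0" and "H = gev_cdf \<xi> \<mu> \<sigma>"
    and "\<And>n. n \<ge> 1 \<Longrightarrow> c n > 0"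
    and "\<And>x. (\<lambda>n. \<P>(\<omega> in M'. (running_max X' n \<omega> - d n) / c n \<le> x)) \<longlonglongrightarrow> H x"
  shows
    "(\<forall>(r :: nat \<Rightarrow> real) (D :: real \<Rightarrow> real).
        (\<forall>n\<ge>1. r n > 0) \<longrightarrow> filterlim r at_top sequentially \<longrightarrow> continuous_on {0..1} D \<longrightarrow>
        (\<forall>u\<in>{0..1}. (\<lambda>n. diagonal_power_distortion M X F r n u) \<longlonglongrightarrow> D u) \<longrightarrow>
          (\<forall>x. (\<lambda>n. \<P>(\<omega> in M. (running_max X n \<omega> - d (nat \<lceil>r n\<rceil>)) / c (nat \<lceil>r n\<rceil>) \<le> x))
                 \<longlonglongrightarrow> (D \<circ> H) x) \<and>
          distribution_function_on_unit D \<and> continuous_on {0..1} D) \<and>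
     (\<forall>(r :: nat \<Rightarrow> real) (D :: real \<Rightarrow> real).
        (\<forall>n\<ge>1. r n > 0) \<longrightarrow> (\<lambda>n. 1 / r n) \<in> O(\<lambda>n. 1 / real n) \<longrightarrow>
        distribution_function_on_unit D \<longrightarrow>
        (\<forall>x. isCont (D \<circ> H) x \<longrightarrow>
           (\<lambda>n. \<P>(\<omega> in M. (running_max X n \<omega> - d (nat \<lceil>r n\<rceil>)) / c (nat \<lceil>r n\<rceil>) \<le> x))
             \<longlonglongrightarrow> (D \<circ> H) x) \<longrightarrow>
        (\<forall>u. u \<in> {0, 1} \<or> u \<in> {0<..<1} \<and> isCont D u \<longrightarrow>
           (\<lambda>n. diagonal_power_distortion M X F r n u) \<longlonglongrightarrow> D u))"
proof -
  interpret M: prob_space M by fact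
  note Xm = assms(2) and F = assms(3)
  have Fprob: "\<P>(\<omega> in M. X i \<omega> \<le> x) = F x" if i: "i \<ge> 1" for i x
    unfolding F[OF i, symmetric] using Xm[OF i]
    by (auto simp: cdf_def measure_distr intro!: arg_cong[where f="measure M"])
  have cont: "isCont F x" for x
    using assms(4) by (simp add: continuous_on_eq_continuous_at)
  have F01: "0 \<le> F x" "F x \<le> 1" for x
    unfolding Fprob[of 1, OF order.refl, symmetric] by auto
  have cop: "is_copula_of M X F n (copula_of M X F n)" for n
    unfolding copula_of_def by (rule theI'[OF ex1_copula_of[OF assms(1) Xm Fprob cont]])
  \<comment> \<open>The event that the maximum is at most \<open>y\<close> is the joint event with
    all thresholds equal to \<open>y\<close>, so its probability is the copula at equal arguments
    \<open>F y\<close>.\<close>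
  have diag: "copula_diagonal M X F n (F y) = \<P>(\<omega> in M. running_max X n \<omega> \<le> y)"
    if "n \<ge> 1" for n y
    using cop[of n] that by (simp add: is_copula_of_def copula_diagonal_def running_max_le_iff)

  let ?G = "diagonal_power_distortion M X F"
  have G01: "?G r n 0 = 0" "?G r n 1 = 1" if "n \<ge> 1" for r n
    using cop[of n] copula_diag_0_1[of n] that
    by (auto simp: diagonal_power_distortion_def copula_diagonal_def is_copula_of_def)
  have Gmono: "mono_on {0..1} (?G r n)" if "r n > 0" for r n
  proof (rule mono_onI)
    fix u v :: real assume uv: "u \<in> {0..1}" "v \<in> {0..1}" "u \<le> v"
    have "u powr (1 / r n) \<le> v powr (1 / r n)" "v powr (1 / r n) \<le> 1"
      using uv that by (auto intro!: powr_mono2 powr_le1)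
    thus "?G r n u \<le> ?G r n v"
      using cop[of n] unfolding diagonal_power_distortion_def copula_diagonal_def is_copula_of_def
      by (intro copula_diag_mono) auto
  qed

  \<comment> \<open>By independence the iid assumption becomes a statement about powers of
    \<open>F\<close> alone. Only indices from 1 on matter, where \<open>c k\<close> is positive and
    the inequality can be rescaled.\<close>
  have pow: "(\<lambda>k. F (c k * x + d k) ^ k) \<longlonglongrightarrow> H x" for x
  proof (rule Lim_transform_eventually[OF assms(11)[of x]])
    show "\<forall>\<^sub>F k in sequentially. \<P>(\<omega> in M'. (running_max X' k \<omega> - d k) / c k \<le> x) = F (c k * x + d k) ^ k"
      using eventually_ge_at_top[of 1]
    proof eventually_elim
      case (elim k)
      show ?case
        using prob_running_max_iid[OF assms(5,6,7) elim] assms(10)[OF elim]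
        by (simp add: pos_divide_le_eq algebra_simps)
    qed
  qed
  define V where "V r x n = F (c (nat \<lceil>r n\<rceil>) * x + d (nat \<lceil>r n\<rceil>)) powr r n"
    for r :: "nat \<Rightarrow> real" and x n
  have V: "V r x \<longlonglongrightarrow> H x" if "filterlim r at_top sequentially" for r x
    using tendsto_power_to_powr_rate[of "\<lambda>k. F (c k * x + d k)", OF F01(1) pow that]
    unfolding V_def .
  have V01: "V r x n \<in> {0..1}" if "r n > 0" for r x n
    using that F01 by (auto simp: V_def intro!: powr_le1)
  \<comment> \<open>The exponent \<open>1 / r n\<close> in the distortion undoes the power
    \<open>r n\<close> in \<open>V\<close>, leaving the diagonal at \<open>F y\<close>. This
    identity is exact for every \<open>n \<ge> 1\<close>; limits enter only through
    \<open>V\<close>.\<close>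
  have key: "\<P>(\<omega> in M. (running_max X n \<omega> - d (nat \<lceil>r n\<rceil>)) / c (nat \<lceil>r n\<rceil>) \<le> x) = ?G r n (V r x n)"
    if n: "n \<ge> 1" and r: "r n > 0" for r n x
  proof -
    have "nat \<lceil>r n\<rceil> \<ge> 1" using r by (simp add: Suc_le_eq)
    hence "c (nat \<lceil>r n\<rceil>) > 0" by (rule assms(10))
    thus ?thesis
      using diag[OF n, of "c (nat \<lceil>r n\<rceil>) * x + d (nat \<lceil>r n\<rceil>)"] r F01(1)
      by (simp add: diagonal_power_distortion_def V_def powr_powr pos_divide_le_eq algebra_simps)
  qed
  have key_lim: "(\<lambda>n. \<P>(\<omega> in M. (running_max X n \<omega> - d (nat \<lceil>r n\<rceil>)) / c (nat \<lceil>r n\<rceil>) \<le> x)) \<longlonglongrightarrow> L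
      \<longleftrightarrow> (\<lambda>n. ?G r n (V r x n)) \<longlonglongrightarrow> L" if "\<forall>n\<ge>1. r n > 0" for r x L
    by (rule tendsto_cong, use eventually_ge_at_top[of 1] in eventually_elim) (use key that in simp)
  have H01: "H x \<in> {0..1}" for x unfolding assms(9) by (rule gev_cdf_in_unit)
  \<comment> \<open>The endpoint values are exact for all \<open>n \<ge> 1\<close>. They force
    \<open>D 0 = 0\<close> and \<open>D 1 = 1\<close> in part (i) and settle the endpoints in part
    (ii).\<close>
  have ends: "(\<lambda>n. ?G r n 0) \<longlonglongrightarrow> 0" "(\<lambda>n. ?G r n 1) \<longlonglongrightarrow> 1" for r
    by (rule tendsto_eventually, use eventually_ge_at_top[of 1] in eventually_elim, use G01 in simp)+

  show ?thesis
  proof (intro conjI allI impI)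
    fix r :: "nat \<Rightarrow> real" and D :: "real \<Rightarrow> real" and x
    assume r: "\<forall>n\<ge>1. r n > 0" "filterlim r at_top sequentially" and D: "continuous_on {0..1} D"
      and lim: "\<forall>u\<in>{0..1}. (\<lambda>n. ?G r n u) \<longlonglongrightarrow> D u"
    show "(\<lambda>n. \<P>(\<omega> in M. (running_max X n \<omega> - d (nat \<lceil>r n\<rceil>)) / c (nat \<lceil>r n\<rceil>) \<le> x)) \<longlonglongrightarrow> (D \<circ> H) x"
      unfolding key_lim[OF r(1)] comp_def
      by (rule tendsto_along_mono[OF _ _ D V[OF r(2)]]) (use r Gmono lim V01 H01 in auto)
    show "distribution_function_on_unit D"
      unfolding distribution_function_on_unit_def
    proof (intro conjI ballI)
      show "mono_on {0..1} D"
      proof (rule mono_onI)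
        fix u v :: real assume uv: "u \<in> {0..1}" "v \<in> {0..1}" "u \<le> v"
        show "D u \<le> D v"
        proof (rule tendsto_le[OF _ lim[rule_format, OF uv(2)] lim[rule_format, OF uv(1)]])
          show "\<forall>\<^sub>F n in sequentially. ?G r n u \<le> ?G r n v"
            using eventually_ge_at_top[of 1]
            by eventually_elim (use uv r in \<open>auto intro: mono_onD[OF Gmono]\<close>)
        qed simp
      qed
      show "D 0 = 0" "D 1 = 1"
        using lim ends[of r] by (auto intro: LIMSEQ_unique)
      fix u :: real assume u: "u \<in> {0..<1}"
      have "continuous (at u within {0..1}) D"
        using D u by (simp add: continuous_on_eq_continuous_within)
      hence "continuous (at u within {u<..1}) D"
        by (rule continuous_within_subset) (use u in auto)
      \<comment> \<open>Since \<open>u < 1\<close>, the bound 1 is invisible near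
        \<open>u\<close>.\<close>
      moreover have "at u within {u<..1} = at_right u"
        using u by (intro at_within_nhd[of u "{..<1}"]) auto
      ultimately show "continuous (at_right u) D" by simp
    qed
    show "continuous_on {0..1} D" by fact
  next
    fix r :: "nat \<Rightarrow> real" and D :: "real \<Rightarrow> real" and u
    assume r: "\<forall>n\<ge>1. r n > 0" and O: "(\<lambda>n. 1 / r n) \<in> O(\<lambda>n. 1 / real n)"
      and D: "distribution_function_on_unit D"
      and lim: "\<forall>x. isCont (D \<circ> H) x \<longrightarrow>
        (\<lambda>n. \<P>(\<omega> in M. (running_max X n \<omega> - d (nat \<lceil>r n\<rceil>)) / c (nat \<lceil>r n\<rceil>) \<le> x)) \<longlonglongrightarrow> (D \<circ> H) x"
      and u: "u \<in> {0, 1} \<or> u \<in> {0<..<1} \<and> isCont D u"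
    \<comment> \<open>The growth condition makes \<open>1 / r n\<close> vanish, and positivity of
      \<open>r\<close> turns this into divergence to plus infinity, which the limit of
      \<open>V\<close> requires.\<close>
    have "(\<lambda>n. 1 / real n) \<in> o(\<lambda>_. 1)" by real_asymp
    with O have "(\<lambda>n. 1 / r n) \<in> o(\<lambda>_. 1)" by (rule landau_o.big_small_trans)
    hence "(\<lambda>n. 1 / r n) \<longlonglongrightarrow> 0" by (auto dest: smalloD_tendsto)
    moreover have "\<forall>\<^sub>F n in sequentially. 0 < 1 / r n"
      using eventually_ge_at_top[of 1] by eventually_elim (use r in simp)
    ultimately have "filterlim (\<lambda>n. inverse (1 / r n)) at_top sequentially"
      by (rule filterlim_inverse_at_top)
    hence r_top: "filterlim r at_top sequentially" by simp
    \<comment> \<open>Take \<open>v = V r x\<close> with \<open>H x = w\<close>. Continuity of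
      \<open>H\<close> at \<open>x\<close> and of \<open>D\<close> at \<open>w\<close> makes
      \<open>x\<close> a continuity point of \<open>D \<circ> H\<close>, so the assumed convergence
      of the maxima applies there.\<close>
    have seq: "\<exists>v. v \<longlonglongrightarrow> w \<and> (\<forall>n\<ge>1. v n \<in> {0..1}) \<and> (\<lambda>n. ?G r n (v n)) \<longlonglongrightarrow> D w"
      if w: "0 < w" "w < 1" "isCont D w" for w
    proof -
      obtain x where x: "H x = w" "isCont H x"
        using gev_cdf_attains[OF assms(8) w(1,2)] unfolding assms(9) by blast
      have "isCont (D \<circ> H) x" using x w(3) by (intro continuous_at_compose) auto
      hence "(\<lambda>n. ?G r n (V r x n)) \<longlonglongrightarrow> D w"
        using lim x unfolding key_lim[OF r] by auto
      thus ?thesis using V[OF r_top, of x] V01 r x by blast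
    qed
    from u consider "u = 0" | "u = 1" | "0 < u" "u < 1" "isCont D u" by auto
    thus "(\<lambda>n. ?G r n u) \<longlonglongrightarrow> D u"
    proof cases
      case 3
      show ?thesis
        by (rule tendsto_at_isCont_mono[OF _ _ seq 3])
          (use r Gmono D in \<open>auto simp: distribution_function_on_unit_def\<close>)
    qed (use ends D in \<open>auto simp: distribution_function_on_unit_def\<close>)
  qed
qed

end
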